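(* None of the measure-dimension mappings $\dim_H^0$, $\dim_H^1$, $\dim_C$, $\dim_{MC}$ is in general continuous on $\mathcal{M}(X)$ under the weak, the setwise, or the total variation topology. That is, for each of these four mappings and each of these three topologies there is a metric space $X$ such that the mapping is not continuous on (its domain of definition in) $\mathcal{M}(X)$ with respect to that topology.
   Context: $\mathcal{M}(X)$ is the set of Borel probability measures on the metric space $X$, $\mathscr{A}$ the Borel $\sigma$-algebra, $HD$ the Hausdorff dimension, $B(x,r)$ the closed ball. Define $\dim_H^0\nu=\inf\{HD(A):A\in\mathscr{A},\nu(A)>0\}$, $\dim_H^1\nu=\inf\{HD(A):A\in\mathscr{A},\nu(A)=1\}$, $$\dim_C\nu=\lim_{r\to0}\frac{\log\int\nu(B(x,r))\,d\nu(x)}{\log r},\qquad \dim_{MC}\nu=\lim_{\delta\to0}\ \sup_{\{A\in\mathscr{A}:\,\nu(A)\ge1-\delta\}}\ \lim_{r\to0}\frac{\log\int_A\nu(B(x,r))\,d\nu(x)}{\log r},$$ the last two being defined when the limits exist. Convergence $\nu_n\to\nu$ is: weak if $\int f\,d\nu_n\to\int f\,d\nu$ for all bounded continuous $f:X\to\mathbb{R}$; setwise if $\nu_n(A)\to\nu(A)$ for all $A\in\mathscr{A}$; in total variation if $\|\nu_n-\nu\|_{TV}:=\sup_{A\in\mathscr{A}}|\nu_n(A)-\nu(A)|\to0$. *)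

theory Defs
  imports "HOL-Probability.Probability"
begin

text \<open>The extended logarithm on the nonnegative reals, with \<open>log 0 = -\<infinity>\<close>
  (the library has \<open>ln 0 = 0\<close>).\<close>
definition ln_ext :: "real \<Rightarrow> ereal" where
  "ln_ext t = (if t \<le> 0 then -\<infinity> else ereal (ln t))"

context Metric_space
begin

subsection \<open>Hausdorff dimension\<close>

definition mdiam :: "'a set \<Rightarrow> ennreal" where
  "mdiam U = (SUP x\<in>U. SUP y\<in>U. ennreal (d x y))"

text \<open>The term \<open>(diam U)\<^sup>s\<close> for \<open>U\<close> of finite diameter. The exponent 0 is treated separately
  because \<open>0 powr 0 = 0\<close>, whereas a nonempty set of diameter 0 has to contribute 1.\<close>
definition diam_powr :: "real \<Rightarrow> 'a set \<Rightarrow> ennreal" where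
  "diam_powr s U =
     (if U = {} then 0 else if s = 0 then 1 else ennreal (enn2real (mdiam U) powr s))"

text \<open>Infima over the empty family of covers are \<open>\<infinity>\<close>.\<close>
definition hausdorff_pre :: "real \<Rightarrow> real \<Rightarrow> 'a set \<Rightarrow> ennreal" where
  "hausdorff_pre \<epsilon> s A =
     (INF U\<in>{U :: nat \<Rightarrow> 'a set. (\<forall>i. U i \<subseteq> M \<and> mdiam (U i) \<le> ennreal \<epsilon>) \<and> A \<subseteq> (\<Union>i. U i)}.
        \<Sum>i. diam_powr s (U i))"

definition hausdorff_measure :: "real \<Rightarrow> 'a set \<Rightarrow> ennreal" where
  "hausdorff_measure s A = (SUP \<epsilon>\<in>{0<..}. hausdorff_pre \<epsilon> s A)"

definition HD :: "'a set \<Rightarrow> ereal" where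
  "HD A = Inf (ereal ` {s. 0 \<le> s \<and> hausdorff_measure s A = 0})"

subsection \<open>Borel probability measures\<close>

definition mborel :: "'a measure" where
  "mborel = sigma M {U. openin mtopology U}"

definition prob_measures :: "'a measure set" where
  "prob_measures = {\<nu>. sets \<nu> = sets mborel \<and> prob_space \<nu>}"

subsection \<open>The four measure-dimension mappings\<close>

definition dim_H0 :: "'a measure \<Rightarrow> ereal" where
  "dim_H0 \<nu> = Inf {HD A |A. A \<in> sets mborel \<and> measure \<nu> A > 0}"

definition dim_H1 :: "'a measure \<Rightarrow> ereal" where
  "dim_H1 \<nu> = Inf {HD A |A. A \<in> sets mborel \<and> measure \<nu> A = 1}"

definition C_ratio :: "'a measure \<Rightarrow> real \<Rightarrow> ereal" where
  "C_ratio \<nu> r = ln_ext (LINT x|\<nu>. measure \<nu> (mcball x r)) / ereal (ln r)"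

definition dim_C :: "'a measure \<Rightarrow> ereal" where
  "dim_C \<nu> = Lim (at_right 0) (C_ratio \<nu>)"

definition dim_C_domain :: "'a measure set" where
  "dim_C_domain = {\<nu>\<in>prob_measures. \<exists>L. (C_ratio \<nu> \<longlongrightarrow> L) (at_right 0)}"

definition MC_ratio :: "'a measure \<Rightarrow> 'a set \<Rightarrow> real \<Rightarrow> ereal" where
  "MC_ratio \<nu> A r = ln_ext (LINT x:A|\<nu>. measure \<nu> (mcball x r)) / ereal (ln r)"

definition MC_sup :: "'a measure \<Rightarrow> real \<Rightarrow> ereal" where
  "MC_sup \<nu> \<delta> =
     (SUP A\<in>{A\<in>sets mborel. measure \<nu> A \<ge> 1 - \<delta>}. Lim (at_right 0) (MC_ratio \<nu> A))"

definition dim_MC :: "'a measure \<Rightarrow> ereal" where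
  "dim_MC \<nu> = Lim (at_right 0) (MC_sup \<nu>)"

text \<open>All limits in the definition have to exist: the inner one for every competitor \<open>A\<close>, as soon
  as \<open>\<delta>\<close> is small (only small \<open>\<delta>\<close> matter for the outer limit), and the outer one.\<close>
definition dim_MC_domain :: "'a measure set" where
  "dim_MC_domain = {\<nu>\<in>prob_measures.
     (\<forall>\<^sub>F \<delta> in at_right 0. \<forall>A\<in>sets mborel. measure \<nu> A \<ge> 1 - \<delta> \<longrightarrow>
        (\<exists>L. (MC_ratio \<nu> A \<longlongrightarrow> L) (at_right 0))) \<and>
     (\<exists>L. (MC_sup \<nu> \<longlongrightarrow> L) (at_right 0))}"

subsection \<open>The three topologies on the set of Borel probability measures\<close>

text \<open>The weak and the setwise topology are the coarsest ones for which the evaluations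
  \<open>\<nu> \<mapsto> \<integral>f d\<nu>\<close> and \<open>\<nu> \<mapsto> \<nu>(A)\<close>, respectively, are continuous.\<close>
definition weak_topology :: "'a measure topology" where
  "weak_topology = topology_generated_by
     {{\<nu>\<in>prob_measures. (LINT x|\<nu>. f x) \<in> V} |f V.
        continuous_map mtopology euclideanreal f \<and> bounded (f ` M) \<and> open V}"

definition setwise_topology :: "'a measure topology" where
  "setwise_topology = topology_generated_by
     {{\<nu>\<in>prob_measures. measure \<nu> A \<in> V} |A V. A \<in> sets mborel \<and> open V}"

text \<open>\<^const>\<open>Metric_space\<close> asks for nonnegativity on the whole type, but the supremum below need not
  be bounded outside the set of probability measures; hence the case distinction.\<close>
definition tv_dist :: "'a measure \<Rightarrow> 'a measure \<Rightarrow> real" where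
  "tv_dist \<mu> \<nu> = (if \<mu> \<in> prob_measures \<and> \<nu> \<in> prob_measures
     then (SUP A\<in>sets mborel. \<bar>measure \<mu> A - measure \<nu> A\<bar>) else 0)"

definition tv_topology :: "'a measure topology" where
  "tv_topology = Metric_space.mtopology prob_measures tv_dist"

subsection \<open>Convergent sequences of these topologies\<close>

lemma limitin_generated_evaluations:
  fixes e :: "'i \<Rightarrow> 'b \<Rightarrow> real"
  assumes "I \<noteq> {}"
  shows "limitin (topology_generated_by {{\<nu>\<in>P. e i \<nu> \<in> V} |i V. i \<in> I \<and> open V}) \<sigma> \<nu> F \<longleftrightarrow>
    \<nu> \<in> P \<and> (\<forall>\<^sub>F n in F. \<sigma> n \<in> P) \<and> (\<forall>i\<in>I. ((\<lambda>n. e i (\<sigma> n)) \<longlongrightarrow> e i \<nu>) F)"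
    (is "limitin (topology_generated_by ?S) \<sigma> \<nu> F \<longleftrightarrow> ?R")
proof -
  obtain i0 where i0: "i0 \<in> I" using assms by blast
  have P: "P \<in> ?S" using i0 by (auto intro!: exI[of _ i0] exI[of _ UNIV])
  have US: "\<Union>?S = P" using P by blast
  show ?thesis
  proof
    assume L: "limitin (topology_generated_by ?S) \<sigma> \<nu> F"
    have ev: "\<forall>\<^sub>F n in F. \<sigma> n \<in> U" if "U \<in> ?S" "\<nu> \<in> U" for U
      using limitinD[OF L] topology_generated_by_Basis[OF that(1)] that(2) by blast
    have \<nu>: "\<nu> \<in> P" using limitin_topspace[OF L] US by simp
    moreover have "\<forall>\<^sub>F n in F. \<sigma> n \<in> P" using ev[OF P \<nu>] .
    moreover have "((\<lambda>n. e i (\<sigma> n)) \<longlongrightarrow> e i \<nu>) F" if "i \<in> I" for i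
    proof (rule topological_tendstoI)
      fix V :: "real set" assume V: "open V" "e i \<nu> \<in> V"
      have B: "{\<nu>\<in>P. e i \<nu> \<in> V} \<in> ?S" using that V by blast
      have "\<forall>\<^sub>F n in F. \<sigma> n \<in> {\<nu>\<in>P. e i \<nu> \<in> V}" by (rule ev[OF B]) (use \<nu> V in simp)
      then show "\<forall>\<^sub>F n in F. e i (\<sigma> n) \<in> V" by eventually_elim simp
    qed
    ultimately show ?R by blast
  next
    assume R: ?R
    have "\<nu> \<in> U \<longrightarrow> (\<forall>\<^sub>F n in F. \<sigma> n \<in> U)" if "generate_topology_on ?S U" for U
      using that
    proof induction
      case Empty
      then show ?case by simp
    next
      case (Int a b)
      then show ?case by (auto intro: eventually_conj)
    next
      case (UN K)
      show ?case
      proof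
        assume "\<nu> \<in> \<Union>K"
        then obtain k where k: "k \<in> K" "\<nu> \<in> k" by blast
        then have "\<forall>\<^sub>F n in F. \<sigma> n \<in> k" using UN.IH by blast
        then show "\<forall>\<^sub>F n in F. \<sigma> n \<in> \<Union>K" by eventually_elim (use k in blast)
      qed
    next
      case (Basis s)
      then obtain i V where s: "s = {\<nu>\<in>P. e i \<nu> \<in> V}" "i \<in> I" "open V" by blast
      have "((\<lambda>n. e i (\<sigma> n)) \<longlongrightarrow> e i \<nu>) F" using R s by blast
      then have "\<forall>\<^sub>F n in F. e i (\<sigma> n) \<in> V" if "e i \<nu> \<in> V"
        using topological_tendstoD s(3) that by blast
      then show ?case using R s by (auto simp: eventually_conj_iff)
    qed
    then show "limitin (topology_generated_by ?S) \<sigma> \<nu> F"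
      using R US unfolding limitin_def
      by (simp add: openin_topology_generated_by_iff)
  qed
qed

lemma limitin_weak_topology:
  "limitin weak_topology \<sigma> \<nu> F \<longleftrightarrow> \<nu> \<in> prob_measures \<and> (\<forall>\<^sub>F n in F. \<sigma> n \<in> prob_measures) \<and>
     (\<forall>f. continuous_map mtopology euclideanreal f \<and> bounded (f ` M) \<longrightarrow>
        ((\<lambda>n. LINT x|\<sigma> n. f x) \<longlongrightarrow> (LINT x|\<nu>. f x)) F)"
proof -
  let ?I = "{f. continuous_map mtopology euclideanreal f \<and> bounded (f ` M)}"
  have "bounded ((\<lambda>x. 0::real) ` M)" by (rule boundedI[of _ 0]) auto
  then have "(\<lambda>x. 0) \<in> ?I" by simp
  then have "?I \<noteq> {}" by blast
  from limitin_generated_evaluations[OF this, of prob_measures "\<lambda>f \<nu>. LINT x|\<nu>. f x"]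
  show ?thesis unfolding weak_topology_def by (simp add: conj_assoc)
qed

lemma limitin_setwise_topology:
  "limitin setwise_topology \<sigma> \<nu> F \<longleftrightarrow> \<nu> \<in> prob_measures \<and> (\<forall>\<^sub>F n in F. \<sigma> n \<in> prob_measures) \<and>
     (\<forall>A\<in>sets mborel. ((\<lambda>n. measure (\<sigma> n) A) \<longlongrightarrow> measure \<nu> A) F)"
proof -
  have "sets mborel \<noteq> {}" using sets.empty_sets by blast
  from limitin_generated_evaluations[OF this, of prob_measures "\<lambda>A \<nu>. measure \<nu> A"]
  show ?thesis unfolding setwise_topology_def .
qed

lemma tv_bdd:
  assumes "\<mu> \<in> prob_measures" "\<nu> \<in> prob_measures"
  shows "bdd_above ((\<lambda>A. \<bar>measure \<mu> A - measure \<nu> A\<bar>) ` sets mborel)"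
proof (rule bdd_aboveI2)
  interpret \<mu>: prob_space \<mu> using assms by (simp add: prob_measures_def)
  interpret \<nu>: prob_space \<nu> using assms by (simp add: prob_measures_def)
  fix A
  show "\<bar>measure \<mu> A - measure \<nu> A\<bar> \<le> 1"
    using \<mu>.prob_le_1[of A] \<nu>.prob_le_1[of A] measure_nonneg[of \<mu> A] measure_nonneg[of \<nu> A]
    by linarith
qed

lemma tv_upper:
  assumes "\<mu> \<in> prob_measures" "\<nu> \<in> prob_measures" "A \<in> sets mborel"
  shows "\<bar>measure \<mu> A - measure \<nu> A\<bar> \<le> tv_dist \<mu> \<nu>"
  using cSUP_upper[OF assms(3) tv_bdd[OF assms(1,2)]] assms(1,2) by (simp add: tv_dist_def)

lemma Metric_space_tv: "Metric_space prob_measures tv_dist"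
proof
  fix \<mu> \<nu> :: "'a measure"
  have ne: "{} \<in> sets mborel" by simp
  show "0 \<le> tv_dist \<mu> \<nu>"
  proof (cases "\<mu> \<in> prob_measures \<and> \<nu> \<in> prob_measures")
    case True
    then show ?thesis using tv_upper[of \<mu> \<nu>, OF _ _ ne] by simp
  qed (auto simp: tv_dist_def)
  show "tv_dist \<mu> \<nu> = tv_dist \<nu> \<mu>"
    by (auto simp: tv_dist_def abs_minus_commute)
  show "tv_dist \<mu> \<nu> = 0 \<longleftrightarrow> \<mu> = \<nu>" if P: "\<mu> \<in> prob_measures" "\<nu> \<in> prob_measures"
  proof
    interpret \<mu>: prob_space \<mu> using P by (simp add: prob_measures_def)
    interpret \<nu>: prob_space \<nu> using P by (simp add: prob_measures_def)
    assume 0: "tv_dist \<mu> \<nu> = 0"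
    show "\<mu> = \<nu>"
    proof (rule measure_eqI)
      show "sets \<mu> = sets \<nu>" using P by (simp add: prob_measures_def)
      fix A assume "A \<in> sets \<mu>"
      then have "A \<in> sets mborel" using P by (simp add: prob_measures_def)
      from tv_upper[OF P this] have "measure \<mu> A = measure \<nu> A" using 0 by simp
      then show "emeasure \<mu> A = emeasure \<nu> A"
        by (simp add: \<mu>.emeasure_eq_measure \<nu>.emeasure_eq_measure)
    qed
  next
    assume "\<mu> = \<nu>"
    moreover have "(SUP A\<in>sets mborel. 0) = (0::real)"
      by (rule cSUP_const) (use ne in blast)
    ultimately show "tv_dist \<mu> \<nu> = 0"
      by (simp add: tv_dist_def)
  qed
next
  fix \<mu> \<nu> \<rho> :: "'a measure"
  assume P: "\<mu> \<in> prob_measures" "\<nu> \<in> prob_measures" "\<rho> \<in> prob_measures"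
  have "\<bar>measure \<mu> A - measure \<rho> A\<bar> \<le> tv_dist \<mu> \<nu> + tv_dist \<nu> \<rho>" if "A \<in> sets mborel" for A
    using tv_upper[OF P(1,2) that] tv_upper[OF P(2,3) that] by linarith
  moreover have "sets mborel \<noteq> {}" using sets.empty_sets by blast
  ultimately have "(SUP A\<in>sets mborel. \<bar>measure \<mu> A - measure \<rho> A\<bar>) \<le> tv_dist \<mu> \<nu> + tv_dist \<nu> \<rho>"
    by (intro cSUP_least) auto
  then show "tv_dist \<mu> \<rho> \<le> tv_dist \<mu> \<nu> + tv_dist \<nu> \<rho>"
    using P by (simp add: tv_dist_def[of \<mu> \<rho>])
qed

lemma limitin_tv_topology:
  "limitin tv_topology \<sigma> \<nu> F \<longleftrightarrow> \<nu> \<in> prob_measures \<and> (\<forall>\<^sub>F n in F. \<sigma> n \<in> prob_measures) \<and>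
     ((\<lambda>n. SUP A\<in>sets mborel. \<bar>measure (\<sigma> n) A - measure \<nu> A\<bar>) \<longlongrightarrow> 0) F"
proof -
  have "((\<lambda>n. tv_dist (\<sigma> n) \<nu>) \<longlongrightarrow> 0) F \<longleftrightarrow>
      ((\<lambda>n. SUP A\<in>sets mborel. \<bar>measure (\<sigma> n) A - measure \<nu> A\<bar>) \<longlongrightarrow> 0) F"
    if "\<nu> \<in> prob_measures" "\<forall>\<^sub>F n in F. \<sigma> n \<in> prob_measures"
    by (rule tendsto_cong) (use that in \<open>auto simp: tv_dist_def elim: eventually_mono\<close>)
  then show ?thesis
    unfolding tv_topology_def Metric_space.limitin_metric_dist_null[OF Metric_space_tv] by blast
qed

end

end

theory Submission
  imports Defs
begin

text \<open>All twelve cases are settled on the real line by one path of measures. Let \<open>U\<close> be the uniform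
  distribution on \<open>[0,1]\<close> and move all of its mass on \<open>[0,t]\<close> to the point \<open>0\<close>; call the result
  \<open>collapsed t\<close>. It has an atom of mass \<open>t\<close> at \<open>0\<close> and agrees with Lebesgue measure on \<open>(t,1]\<close>, so the
  path leads from \<open>U\<close> (at \<open>t = 0\<close>) to the Dirac measure at \<open>0\<close> (at \<open>t = 1\<close>). Passing from \<open>s\<close> to \<open>t\<close>
  displaces only a mass \<open>\<bar>t - s\<bar>\<close>, hence integrals of functions bounded by \<open>B\<close> change by at most
  \<open>2 B \<bar>t - s\<bar>\<close> (\<open>integral_collapsed_diff_le\<close>), and the path is continuous for all three topologies
  at once (\<open>limitin_collapsed\<close>).

  The dimensions nevertheless jump at an end of the path. An atom, however light, forces
  \<open>dim_H0\<close>, \<open>dim_C\<close> and \<open>dim_MC\<close> to be \<open>0\<close>: a point has Hausdorff dimension \<open>0\<close>, and the integrals of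
  \<open>\<nu>(B(x,r))\<close> stay bounded away from \<open>0\<close>. For \<open>dim_MC\<close> it matters here that \<open>\<delta>\<close> tends to \<open>0\<close> with
  \<open>\<nu>\<close> held fixed, so that eventually no competitor can omit the atom. For \<open>U\<close> itself, the value is at
  least \<open>1\<close>, since sets of positive Lebesgue measure have dimension at least \<open>1\<close> (\<open>one_le_HD\<close>) and
  balls have measure comparable to \<open>r\<close> (\<open>MC_ratio_unif\<close>). So these three jump at \<open>t = 0\<close>. The mapping
  \<open>dim_H1\<close> ignores an atom as long as some diffuse mass remains, and jumps at \<open>t = 1\<close>.\<close>

lemma mborel_eq_borel: "Met_TC.mborel = (borel :: 'a::metric_space measure)"
  unfolding Met_TC.mborel_def borel_def by (simp add: open_openin)

lemma prob_measures_eq: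
  "Met_TC.prob_measures = {\<nu> :: 'a::metric_space measure. sets \<nu> = sets borel \<and> prob_space \<nu>}"
  unfolding Met_TC.prob_measures_def mborel_eq_borel ..

section \<open>Hausdorff dimension\<close>

lemma (in Metric_space) HD_nonneg: "0 \<le> HD A"
  unfolding HD_def by (rule Inf_greatest) auto

lemma (in Metric_space) HD_singleton:
  assumes "a \<in> M"
  shows "HD {a} = 0"
proof -
  have diam: "mdiam {a} = 0"
    using assms by (simp add: mdiam_def)
  have "hausdorff_measure s {a} = 0" if "0 < s" for s
  proof -
    have null: "diam_powr s {a} = 0"
      using that by (simp add: diam_powr_def diam)
    have "hausdorff_pre \<epsilon> s {a} = 0" if "0 < \<epsilon>" for \<epsilon>
    proof -
      have "hausdorff_pre \<epsilon> s {a} \<le> (\<Sum>i::nat. diam_powr s {a})"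
        unfolding hausdorff_pre_def by (rule INF_lower) (use assms diam in simp)
      then show ?thesis by (simp add: null)
    qed
    then show ?thesis
      unfolding hausdorff_measure_def by (intro SUP_eq_const) auto
  qed
  then have "HD {a} \<le> ereal s" if "0 < s" for s
    unfolding HD_def using that by (intro Inf_lower) auto
  then have "HD {a} \<le> 0"
    using ereal_le_epsilon2[of "HD {a}" 0] by simp
  then show ?thesis using HD_nonneg[of "{a}"] by (rule antisym)
qed

lemma (in Metric_space) mdiam_le_diam_powr:
  assumes "mdiam U \<le> 1" "0 \<le> s" "s \<le> 1"
  shows "mdiam U \<le> diam_powr s U"
proof (cases "U = {}")
  case True
  then show ?thesis by (simp add: mdiam_def bot_ennreal)
next
  case False
  obtain \<delta> where \<delta>: "mdiam U = ennreal \<delta>" "0 \<le> \<delta>" "\<delta> \<le> 1"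
    using assms(1) by (cases "mdiam U") (auto simp: top_unique)
  have "\<delta> \<le> \<delta> powr s"
  proof (cases "\<delta> = 0")
    case False
    then have "\<delta> powr 1 \<le> \<delta> powr s"
      using \<delta> assms by (intro powr_mono') auto
    then show ?thesis using \<delta> by simp
  qed simp
  then show ?thesis
    using False \<delta> assms(1) by (auto simp: diam_powr_def intro: ennreal_leI)
qed

text \<open>The mass distribution principle for Lebesgue measure: a set \<open>U\<close> of diameter \<open>\<delta>\<close> lies in the
  interval of radius \<open>\<delta>\<close> around any of its points, which accounts for the factor \<open>2\<close>; and
  \<open>\<delta> \<le> \<delta>\<^sup>s\<close> as long as \<open>\<delta> \<le> 1\<close>, which is the reason for the scale \<open>1\<close>.\<close>

lemma lborel_le_hausdorff_pre:
  fixes A :: "real set"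
  assumes s: "0 \<le> s" "s \<le> 1"
  shows "emeasure lborel A \<le> 2 * Met_TC.hausdorff_pre 1 s A"
proof -
  have "emeasure lborel A / 2 \<le> (\<Sum>i. Met_TC.diam_powr s (U i))"
    if U: "\<And>i. Met_TC.mdiam (U i) \<le> 1" and A: "A \<subseteq> (\<Union>i. U i)" for U :: "nat \<Rightarrow> real set"
  proof -
    have "\<exists>J\<in>sets borel. U i \<subseteq> J \<and> emeasure lborel J \<le> 2 * Met_TC.mdiam (U i)" for i
    proof (cases "U i = {}")
      case False
      then obtain x where x: "x \<in> U i" by blast
      obtain \<delta> where \<delta>: "Met_TC.mdiam (U i) = ennreal \<delta>" "0 \<le> \<delta>"
        using U[of i] by (cases "Met_TC.mdiam (U i)") (auto simp: top_unique)
      have "ennreal (dist x y) \<le> ennreal \<delta>" if "y \<in> U i" for y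
        unfolding \<delta>(1)[symmetric] Met_TC.mdiam_def
        by (rule SUP_upper2[OF x]) (rule SUP_upper[OF that])
      then have "U i \<subseteq> {x - \<delta>..x + \<delta>}"
        using \<delta>(2) by (force simp: dist_real_def abs_le_iff)
      moreover have "emeasure lborel {x - \<delta>..x + \<delta>} = 2 * ennreal \<delta>"
        using \<delta>(2) by (simp add: ennreal_mult')
      ultimately show ?thesis
        using \<delta>(1) by (intro bexI[of _ "{x - \<delta>..x + \<delta>}"]) auto
    qed (auto intro!: bexI[of _ "{}"])
    then obtain J where J: "\<And>i. J i \<in> sets borel" "\<And>i. U i \<subseteq> J i"
      "\<And>i. emeasure lborel (J i) \<le> 2 * Met_TC.mdiam (U i)" by metis
    have "emeasure lborel A \<le> emeasure lborel (\<Union>i. J i)"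
      using J(1) by (intro emeasure_mono subset_trans[OF A UN_mono] J(2)) auto
    also have "\<dots> \<le> (\<Sum>i. emeasure lborel (J i))"
      using J(1) by (intro emeasure_subadditive_countably) auto
    also have "\<dots> \<le> (\<Sum>i. 2 * Met_TC.diam_powr s (U i))"
      using order_trans[OF J(3) mult_left_mono[OF Met_TC.mdiam_le_diam_powr[OF U s]]]
      by (intro suminf_le) auto
    also have "\<dots> = 2 * (\<Sum>i. Met_TC.diam_powr s (U i))"
      by (rule ennreal_suminf_cmult)
    finally show ?thesis
      by (auto intro!: divide_le_posI_ennreal)
  qed
  then have "emeasure lborel A / 2 \<le> Met_TC.hausdorff_pre 1 s A"
    unfolding Met_TC.hausdorff_pre_def by (intro INF_greatest) auto
  then have "emeasure lborel A / 2 * 2 \<le> Met_TC.hausdorff_pre 1 s A * 2"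
    by (intro mult_right_mono) auto
  moreover have "emeasure lborel A / 2 * 2 = emeasure lborel A"
    by (simp add: ennreal_divide_times ennreal_mult_divide_eq)
  ultimately show ?thesis by (simp add: mult.commute)
qed

lemma one_le_HD:
  fixes A :: "real set"
  assumes "emeasure lborel A \<noteq> 0"
  shows "1 \<le> Met_TC.HD A"
  unfolding Met_TC.HD_def
proof (rule Inf_greatest, clarify)
  fix s :: real
  assume s: "0 \<le> s" and null: "Met_TC.hausdorff_measure s A = 0"
  have "Met_TC.hausdorff_pre 1 s A \<le> Met_TC.hausdorff_measure s A"
    unfolding Met_TC.hausdorff_measure_def by (rule SUP_upper) simp
  then have "Met_TC.hausdorff_pre 1 s A = 0" using null by simp
  then have "\<not> s \<le> 1"
    using lborel_le_hausdorff_pre[of s A] s assms by auto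
  then show "1 \<le> ereal s" by (simp add: one_ereal_def)
qed

section \<open>Correlation dimension\<close>

text \<open>The measure of the ball around \<open>x\<close> is that of the \<open>x\<close>-section of the closed set
  \<open>{(x, y). dist x y \<le> r}\<close>. Second countability makes this set measurable for the product of the two
  Borel algebras.\<close>

lemma borel_measurable_measure_cball:
  fixes \<nu> :: "'a::{metric_space, second_countable_topology} measure"
  assumes "prob_space \<nu>" and sets: "sets \<nu> = sets borel"
  shows "(\<lambda>x. measure \<nu> (cball x r)) \<in> borel_measurable borel"
proof -
  interpret prob_space \<nu> by fact
  have "closed {p :: 'a \<times> 'a. dist (fst p) (snd p) \<le> r}"
    by (intro closed_Collect_le continuous_intros)
  then have "{p :: 'a \<times> 'a. dist (fst p) (snd p) \<le> r} \<in> sets (borel \<Otimes>\<^sub>M \<nu>)"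
    unfolding sets_pair_measure_cong[OF refl sets] borel_prod by (rule borel_closed)
  from measurable_emeasure_Pair[OF this] have "(\<lambda>x. emeasure \<nu> (cball x r)) \<in> borel_measurable borel"
    by (simp add: vimage_def cball_def)
  then show ?thesis unfolding measure_def by measurable
qed

lemma set_integral_measure_cball_bounds:
  fixes \<nu> :: "'a::{metric_space, second_countable_topology} measure"
  assumes "prob_space \<nu>" and sets: "sets \<nu> = sets borel"
    and A: "A \<in> sets borel" and E: "E \<in> sets borel" "E \<subseteq> A"
    and lower: "\<And>x. x \<in> E \<Longrightarrow> c \<le> measure \<nu> (cball x r)"
    and upper: "\<And>x. measure \<nu> (cball x r) \<le> C"
  shows "c * measure \<nu> E \<le> (LINT x:A|\<nu>. measure \<nu> (cball x r))"
    and "(LINT x:A|\<nu>. measure \<nu> (cball x r)) \<le> C"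
proof -
  interpret prob_space \<nu> by fact
  have [measurable]: "A \<in> sets \<nu>" "E \<in> sets \<nu>" using A E sets by auto
  have [measurable]: "(\<lambda>x. measure \<nu> (cball x r)) \<in> borel_measurable \<nu>"
    using borel_measurable_measure_cball[OF assms(1) sets, of r] sets
    by (simp cong: measurable_cong_sets)
  have int: "integrable \<nu> (\<lambda>x. indicator A x *\<^sub>R measure \<nu> (cball x r))"
    by (rule integrable_const_bound[of _ 1]) (auto simp: indicator_def)
  have intE: "integrable \<nu> (\<lambda>x. c * indicator E x)"
    by (intro integrable_mult_right integrable_real_indicator) (auto simp: less_top[symmetric])
  have C: "0 \<le> C" using upper[of undefined] measure_nonneg[of \<nu>] order_trans by blast
  have "c * measure \<nu> E = (LINT x|\<nu>. c * indicator E x)" by simp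
  also have "\<dots> \<le> (LINT x:A|\<nu>. measure \<nu> (cball x r))"
    unfolding set_lebesgue_integral_def
    by (rule integral_mono[OF intE int]) (use lower E in \<open>auto simp: indicator_def\<close>)
  finally show "c * measure \<nu> E \<le> (LINT x:A|\<nu>. measure \<nu> (cball x r))" .
  have "(LINT x:A|\<nu>. measure \<nu> (cball x r)) \<le> (LINT x|\<nu>. C)"
    unfolding set_lebesgue_integral_def
    by (rule integral_mono[OF int]) (use upper C in \<open>auto simp: indicator_def\<close>)
  then show "(LINT x:A|\<nu>. measure \<nu> (cball x r)) \<le> C"
    by (simp add: prob_space)
qed

text \<open>Multiplicative constants are invisible on the logarithmic scale because \<open>ln r \<rightarrow> -\<infinity>\<close>. The
  exponent \<open>s = 0\<close> is included and will be used for measures with an atom.\<close>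

lemma tendsto_ln_ext_ratio:
  assumes "0 < c"
    and bounds: "\<forall>\<^sub>F r in at_right 0. c * r powr s \<le> F r \<and> F r \<le> C * r powr s"
  shows "((\<lambda>r. ln_ext (F r) / ereal (ln r)) \<longlongrightarrow> ereal s) (at_right 0)"
proof -
  have small: "\<forall>\<^sub>F r::real in at_right 0. 0 < r \<and> r < 1"
    using eventually_at_right_real[of 0 1] by simp
  have lim: "((\<lambda>r::real. ln a / ln r + s) \<longlongrightarrow> s) (at_right 0)" for a
  proof -
    have "((\<lambda>r::real. ln a / ln r) \<longlongrightarrow> 0) (at_right 0)"
      by (rule tendsto_divide_0[OF tendsto_const])
         (rule filterlim_mono[OF ln_at_0 at_bot_le_at_infinity order_refl])
    from tendsto_add[OF this tendsto_const[of s]] show ?thesis by simp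
  qed
  have key: "ln C / ln r + s \<le> ln (F r) / ln r \<and> ln (F r) / ln r \<le> ln c / ln r + s
      \<and> ln_ext (F r) / ereal (ln r) = ereal (ln (F r) / ln r)"
    if r: "0 < r" "r < 1" and F: "c * r powr s \<le> F r" "F r \<le> C * r powr s" for r
  proof -
    have pos: "0 < r powr s" "0 < c * r powr s" using r \<open>0 < c\<close> by auto
    have Fpos: "0 < F r" using pos F by linarith
    then have "0 < C * r powr s" using F by linarith
    then have "0 < C" using pos zero_less_mult_pos2 by blast
    have "ln c + s * ln r \<le> ln (F r)"
      using F(1) pos Fpos \<open>0 < c\<close> r ln_mono[of "c * r powr s" "F r"] by (simp add: ln_mult ln_powr)
    moreover have "ln (F r) \<le> ln C + s * ln r"
      using F(2) pos Fpos \<open>0 < C\<close> r ln_mono[of "F r" "C * r powr s"] by (simp add: ln_mult ln_powr)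
    moreover have "ln r < 0" using r by simp
    ultimately show ?thesis
      using Fpos by (simp add: ln_ext_def divide_simps mult.commute)
  qed
  have "((\<lambda>r. ln (F r) / ln r) \<longlongrightarrow> s) (at_right 0)"
    by (rule tendsto_sandwich[OF _ _ lim[of C] lim[of c]])
       (use eventually_conj[OF small bounds] in \<open>eventually_elim, use key in blast\<close>)+
  then have "((\<lambda>r. ereal (ln (F r) / ln r)) \<longlongrightarrow> ereal s) (at_right 0)"
    by simp
  then show ?thesis
    by (rule Lim_transform_eventually)
       (use eventually_conj[OF small bounds] in \<open>eventually_elim, use key in metis\<close>)
qed

text \<open>The upper estimate on balls has to hold everywhere, but the lower one only on a part \<open>E\<close> of \<open>A\<close>
  of positive measure. This freedom lets one lemma cover both the uniform distribution, where
  \<open>E\<close> is the part of \<open>A\<close> in \<open>[0,1]\<close>, and measures with an atom, where \<open>E\<close> is that atom.\<close>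

lemma MC_ratio_tendsto:
  fixes \<nu> :: "'a::{metric_space, second_countable_topology} measure"
  assumes "prob_space \<nu>" and sets: "sets \<nu> = sets borel"
    and A: "A \<in> sets borel" and E: "E \<in> sets borel" "E \<subseteq> A" "0 < measure \<nu> E"
    and "0 < c"
    and lower: "\<forall>\<^sub>F r in at_right 0. \<forall>x\<in>E. c * r powr s \<le> measure \<nu> (cball x r)"
    and upper: "\<forall>\<^sub>F r in at_right 0. \<forall>x. measure \<nu> (cball x r) \<le> C * r powr s"
  shows "(Met_TC.MC_ratio \<nu> A \<longlongrightarrow> ereal s) (at_right 0)"
  unfolding Met_TC.MC_ratio_def mcball_eq_cball
proof (rule tendsto_ln_ext_ratio)
  show "0 < c * measure \<nu> E" using E(3) \<open>0 < c\<close> by simp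
  show "\<forall>\<^sub>F r in at_right 0. c * measure \<nu> E * r powr s \<le> (LINT x:A|\<nu>. measure \<nu> (cball x r))
      \<and> (LINT x:A|\<nu>. measure \<nu> (cball x r)) \<le> C * r powr s"
    using lower upper
  proof eventually_elim
    case (elim r)
    from set_integral_measure_cball_bounds[OF assms(1) sets A E(1,2), of "c * r powr s" r "C * r powr s"]
    show ?case using elim by (simp add: mult_ac)
  qed
qed

text \<open>If the limit is the same for every set of nearly full measure, then the supremum over
  competitors is constant for small \<open>\<delta>\<close>. The competitor \<open>UNIV\<close> gives the correlation dimension.\<close>

lemma dim_C_dim_MC_eqI:
  fixes \<nu> :: "'a::metric_space measure"
  assumes "prob_space \<nu>" and sets: "sets \<nu> = sets borel" and "0 < \<delta>0"
    and lim: "\<And>A. A \<in> sets borel \<Longrightarrow> 1 - \<delta>0 \<le> measure \<nu> A \<Longrightarrow>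
      (Met_TC.MC_ratio \<nu> A \<longlongrightarrow> s) (at_right 0)"
  shows "\<nu> \<in> Met_TC.dim_C_domain" "Met_TC.dim_C \<nu> = s"
    and "\<nu> \<in> Met_TC.dim_MC_domain" "Met_TC.dim_MC \<nu> = s"
proof -
  interpret prob_space \<nu> by fact
  have P: "\<nu> \<in> Met_TC.prob_measures" using assms by (simp add: prob_measures_eq)
  have full: "measure \<nu> UNIV = 1"
    using prob_space sets_eq_imp_space_eq[OF sets] by simp
  have "Met_TC.C_ratio \<nu> = Met_TC.MC_ratio \<nu> UNIV"
    by (simp add: fun_eq_iff Met_TC.C_ratio_def Met_TC.MC_ratio_def set_lebesgue_integral_def)
  with lim[of UNIV] have C: "(Met_TC.C_ratio \<nu> \<longlongrightarrow> s) (at_right 0)"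
    using full \<open>0 < \<delta>0\<close> by simp
  then show "\<nu> \<in> Met_TC.dim_C_domain" using P by (auto simp: Met_TC.dim_C_domain_def)
  show "Met_TC.dim_C \<nu> = s"
    unfolding Met_TC.dim_C_def by (rule tendsto_Lim[OF _ C]) simp
  have small: "\<forall>\<^sub>F \<delta>::real in at_right 0. 0 < \<delta> \<and> \<delta> < \<delta>0"
    using eventually_at_right_real[OF \<open>0 < \<delta>0\<close>] by simp
  have "Met_TC.MC_sup \<nu> \<delta> = s" if "0 < \<delta>" "\<delta> < \<delta>0" for \<delta>
  proof -
    let ?\<A> = "{A \<in> sets borel. measure \<nu> A \<ge> 1 - \<delta>}"
    have "Lim (at_right 0) (Met_TC.MC_ratio \<nu> A) = s" if "A \<in> ?\<A>" for A
      by (rule tendsto_Lim[OF _ lim]) (use that \<open>\<delta> < \<delta>0\<close> in auto)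
    moreover have "UNIV \<in> ?\<A>" using full that by simp
    ultimately show ?thesis
      unfolding Met_TC.MC_sup_def mborel_eq_borel by (intro SUP_eq_const) auto
  qed
  then have "\<forall>\<^sub>F \<delta> in at_right 0. s = Met_TC.MC_sup \<nu> \<delta>"
    using small by (auto elim: eventually_mono)
  with tendsto_const[of s] have MC: "(Met_TC.MC_sup \<nu> \<longlongrightarrow> s) (at_right 0)"
    by (rule Lim_transform_eventually)
  have "\<forall>\<^sub>F \<delta> in at_right 0. \<forall>A\<in>sets borel. measure \<nu> A \<ge> 1 - \<delta> \<longrightarrow>
      (\<exists>L. (Met_TC.MC_ratio \<nu> A \<longlongrightarrow> L) (at_right 0))"
    using small
  proof eventually_elim
    case (elim \<delta>)
    then show ?case using lim by (meson diff_left_mono less_imp_le order_trans)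
  qed
  with MC P show "\<nu> \<in> Met_TC.dim_MC_domain"
    by (auto simp: Met_TC.dim_MC_domain_def mborel_eq_borel)
  show "Met_TC.dim_MC \<nu> = s"
    unfolding Met_TC.dim_MC_def by (rule tendsto_Lim[OF _ MC]) simp
qed

text \<open>Half the mass of the atom is a threshold for which every competitor must contain the atom. The
  integral then lies between \<open>(\<nu> {a})\<^sup>2\<close> and \<open>1\<close>.\<close>

lemma MC_ratio_tendsto_0_of_atom:
  fixes \<nu> :: "'a::{metric_space, second_countable_topology} measure"
  assumes "prob_space \<nu>" and sets: "sets \<nu> = sets borel" and atom: "0 < measure \<nu> {a}"
    and A: "A \<in> sets borel" "1 - measure \<nu> {a} / 2 \<le> measure \<nu> A"
  shows "(Met_TC.MC_ratio \<nu> A \<longlongrightarrow> 0) (at_right 0)"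
proof -
  interpret prob_space \<nu> by fact
  have [simp]: "space \<nu> = UNIV" using sets_eq_imp_space_eq[OF sets] by simp
  have "a \<in> A"
  proof (rule ccontr)
    assume "a \<notin> A"
    then have "measure \<nu> (A \<union> {a}) = measure \<nu> A + measure \<nu> {a}"
      by (intro finite_measure_Union) (use A sets in auto)
    then show False using A(2) atom prob_le_1[of "A \<union> {a}"] by simp
  qed
  have pos: "\<forall>\<^sub>F r::real in at_right 0. 0 < r" by (rule eventually_at_right_less)
  have "(Met_TC.MC_ratio \<nu> A \<longlongrightarrow> ereal 0) (at_right 0)"
  proof (rule MC_ratio_tendsto[OF assms(1) sets A(1), of "{a}" "measure \<nu> {a}" _ 1])
    show "\<forall>\<^sub>F r in at_right 0. \<forall>x\<in>{a}. measure \<nu> {a} * r powr 0 \<le> measure \<nu> (cball x r)"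
      using pos by eventually_elim (auto intro!: finite_measure_mono simp: sets)
    show "\<forall>\<^sub>F r in at_right 0. \<forall>x. measure \<nu> (cball x r) \<le> 1 * r powr 0"
      using pos by eventually_elim simp
  qed (use \<open>a \<in> A\<close> atom in auto)
  then show ?thesis by (simp add: zero_ereal_def)
qed

section \<open>A path of measures with a growing atom\<close>

definition unif :: "real measure" where
  "unif = uniform_measure lborel {0..1}"

definition collapse :: "real \<Rightarrow> real \<Rightarrow> real" where
  "collapse t x = (if x \<le> t then 0 else x)"

definition collapsed :: "real \<Rightarrow> real measure" where
  "collapsed t = distr unif borel (collapse t)"

lemma sets_unif [simp, measurable_cong]: "sets unif = sets borel"
  by (simp add: unif_def)

lemma space_unif [simp]: "space unif = UNIV"
  by (simp add: unif_def)

interpretation unif: prob_space unif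
  unfolding unif_def by (rule prob_space_uniform_measure) auto

lemma measure_unif: "A \<in> sets borel \<Longrightarrow> measure unif A = measure lborel ({0..1} \<inter> A)"
  unfolding unif_def by (subst measure_uniform_measure) auto

lemma collapse_measurable [measurable]: "collapse t \<in> borel_measurable borel"
  unfolding collapse_def by measurable

lemma sets_collapsed [simp]: "sets (collapsed t) = sets borel"
  by (simp add: collapsed_def)

lemma prob_space_collapsed: "prob_space (collapsed t)"
  unfolding collapsed_def by (rule unif.prob_space_distr) simp

lemma measure_collapsed:
  "A \<in> sets borel \<Longrightarrow> measure (collapsed t) A = measure unif (collapse t -` A)"
  unfolding collapsed_def by (subst measure_distr) auto

lemma measure_unif_Ioc_le:
  assumes "s \<le> t"
  shows "measure unif {s<..t} \<le> t - s"
proof -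
  have "measure unif {s<..t} \<le> measure lborel {s<..t}"
    by (subst measure_unif)
       (use assms in \<open>auto intro!: measure_mono_fmeasurable fmeasurableI simp del: measure_lborel_Ioc\<close>)
  then show ?thesis using assms by simp
qed

lemma measure_unif_atMost:
  assumes "0 \<le> t" "t \<le> 1"
  shows "measure unif {..t} = t"
proof -
  have "{0..1} \<inter> {..t} = {0..t}" using assms by auto
  then show ?thesis using assms by (simp add: measure_unif)
qed

text \<open>Collapsing at \<open>0\<close> moves the negative half-line only, which carries no mass.\<close>

lemma collapsed_0: "collapsed 0 = unif"
proof -
  have "collapsed 0 = distr unif borel (\<lambda>x. x)"
    unfolding collapsed_def
  proof (rule distr_cong_AE)
    show "AE x in unif. collapse 0 x = x"
      unfolding unif_def by (rule AE_uniform_measureI) (auto simp: collapse_def)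
  qed auto
  then show ?thesis by (simp add: distr_id2)
qed

lemma measure_collapsed_atom:
  assumes "0 \<le> t" "t \<le> 1"
  shows "t \<le> measure (collapsed t) {0}"
proof -
  have "measure unif {..t} \<le> measure unif (collapse t -` {0})"
    by (rule unif.finite_measure_mono)
       (use measurable_sets_borel[OF collapse_measurable] in \<open>auto simp: collapse_def\<close>)
  then show ?thesis using assms by (simp add: measure_collapsed measure_unif_atMost)
qed

text \<open>Only the atom can charge a Lebesgue null set. In contrapositive form this serves at both ends
  of the path: a set of positive measure for \<open>t = 0\<close>, or of full measure for \<open>t < 1\<close>, is not a null
  set.\<close>

lemma measure_collapsed_le:
  assumes "0 \<le> t" "t \<le> 1" and A: "A \<in> sets borel" and "emeasure lborel A = 0"
  shows "measure (collapsed t) A \<le> t"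
proof -
  have "measure (collapsed t) A \<le> measure unif ({..t} \<union> A)"
    unfolding measure_collapsed[OF A]
    by (rule unif.finite_measure_mono) (use A in \<open>auto simp: collapse_def split: if_splits\<close>)
  also have "\<dots> \<le> measure unif {..t} + measure unif A"
    by (rule measure_Un_le) (use A in auto)
  also have "measure unif A = 0"
  proof -
    have "emeasure lborel ({0..1} \<inter> A) \<le> emeasure lborel A"
      using A by (intro emeasure_mono) auto
    then show ?thesis using A assms(4) by (simp add: measure_unif[OF A] measure_def[of lborel])
  qed
  finally show ?thesis using assms by (simp add: measure_unif_atMost)
qed

text \<open>A coupling argument: the two measures are the laws of \<open>collapse s\<close> and \<open>collapse t\<close> on one
  probability space, and for \<open>s \<le> t\<close> these random variables differ only on \<open>(s,t]\<close>.\<close>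

lemma integral_collapsed_diff_le:
  fixes h :: "real \<Rightarrow> real"
  assumes h[measurable]: "h \<in> borel_measurable borel" and B: "\<And>x. \<bar>h x\<bar> \<le> B"
  shows "\<bar>(LINT x|collapsed t. h x) - (LINT x|collapsed s. h x)\<bar> \<le> 2 * B * \<bar>t - s\<bar>"
proof (induction s t rule: linorder_wlog)
  case (le s t)
  have int: "integrable unif (\<lambda>x. h (collapse u x))" for u
    by (rule unif.integrable_const_bound[of _ B]) (use B in auto)
  have bound: "\<bar>h (collapse t x) - h (collapse s x)\<bar> \<le> 2 * B * indicator {s<..t} x" for x
    using B[of x] B[of 0] le by (auto simp: collapse_def indicator_def)
  have "0 \<le> B" using B[of 0] by linarith
  have "(LINT x|collapsed t. h x) - (LINT x|collapsed s. h x)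
      = (LINT x|unif. h (collapse t x) - h (collapse s x))"
    unfolding collapsed_def by (simp add: integral_distr Bochner_Integration.integral_diff int)
  also have "\<bar>\<dots>\<bar> \<le> (LINT x|unif. \<bar>h (collapse t x) - h (collapse s x)\<bar>)"
    by (rule integral_abs_bound)
  also have "\<dots> \<le> (LINT x|unif. 2 * B * indicator {s<..t} x)"
    by (rule integral_mono)
       (use bound int in \<open>auto intro!: integrable_mult_right integrable_real_indicator simp: less_top[symmetric]\<close>)
  also have "\<dots> = 2 * B * measure unif {s<..t}" by simp
  also have "\<dots> \<le> 2 * B * \<bar>t - s\<bar>"
    using measure_unif_Ioc_le[OF le] \<open>0 \<le> B\<close> le by (intro mult_left_mono) auto
  finally show ?case .
qed (simp add: abs_minus_commute)

text \<open>The coupling bound is uniform over functions with a common bound. Continuous test functions give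
  weak convergence, a single indicator gives setwise convergence, and the supremum over all
  indicators gives convergence in total variation.\<close>

lemma limitin_collapsed:
  assumes u: "u \<longlonglongrightarrow> t"
    and T: "T \<in> {Met_TC.weak_topology, Met_TC.setwise_topology, Met_TC.tv_topology}"
  shows "limitin T (\<lambda>n. collapsed (u n)) (collapsed t) sequentially"
proof -
  have P: "collapsed s \<in> Met_TC.prob_measures" for s
    by (simp add: prob_measures_eq prob_space_collapsed)
  have null: "(\<lambda>n. 2 * B * \<bar>u n - t\<bar>) \<longlonglongrightarrow> 0" for B
    using tendsto_mult_right_zero[OF tendsto_rabs_zero[OF LIM_zero[OF u]]] .
  have *: "(\<lambda>n. LINT x|collapsed (u n). h x) \<longlonglongrightarrow> (LINT x|collapsed t. h x)"
    if "h \<in> borel_measurable borel" "\<And>x. \<bar>h x\<bar> \<le> B" for h :: "real \<Rightarrow> real" and B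
    by (rule LIM_zero_cancel, rule Lim_null_comparison[OF _ null[of B]])
       (use integral_collapsed_diff_le[OF that] in auto)
  have diff: "\<bar>measure (collapsed (u n)) A - measure (collapsed t) A\<bar> \<le> 2 * \<bar>u n - t\<bar>"
    if A: "A \<in> sets borel" for n A
    using integral_collapsed_diff_le[of "indicator A" 1 "u n" t] A
    by (simp add: sets_eq_imp_space_eq[OF sets_collapsed])
  have weak: "limitin Met_TC.weak_topology (\<lambda>n. collapsed (u n)) (collapsed t) sequentially"
    unfolding Met_TC.limitin_weak_topology
  proof (intro conjI allI impI)
    fix f :: "real \<Rightarrow> real"
    assume f: "continuous_map Met_TC.mtopology euclideanreal f \<and> bounded (range f)"
    then have "f \<in> borel_measurable borel"
      by (intro borel_measurable_continuous_onI) simp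
    moreover obtain B where "\<And>x. \<bar>f x\<bar> \<le> B"
      using f by (auto simp: bounded_iff)
    ultimately show "(\<lambda>n. LINT x|collapsed (u n). f x) \<longlonglongrightarrow> (LINT x|collapsed t. f x)"
      by (rule *)
  qed (use P in auto)
  have setwise: "limitin Met_TC.setwise_topology (\<lambda>n. collapsed (u n)) (collapsed t) sequentially"
    unfolding Met_TC.limitin_setwise_topology mborel_eq_borel
  proof (intro conjI ballI)
    fix A :: "real set" assume A: "A \<in> sets borel"
    show "(\<lambda>n. measure (collapsed (u n)) A) \<longlonglongrightarrow> measure (collapsed t) A"
      by (rule LIM_zero_cancel, rule Lim_null_comparison[OF _ null[of 1]])
         (use diff[OF A] in auto)
  qed (use P in auto)
  have "(\<lambda>n. SUP A\<in>sets borel. \<bar>measure (collapsed (u n)) A - measure (collapsed t) A\<bar>) \<longlonglongrightarrow> 0"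
  proof (rule Lim_null_comparison[OF _ null[of 1]], rule always_eventually, rule allI)
    fix n
    have "0 \<le> (SUP A\<in>sets borel. \<bar>measure (collapsed (u n)) A - measure (collapsed t) A\<bar>)"
      using Met_TC.tv_bdd[OF P P] by (intro cSUP_upper2[where x = "{}"]) (auto simp: mborel_eq_borel)
    moreover have "(SUP A\<in>sets borel. \<bar>measure (collapsed (u n)) A - measure (collapsed t) A\<bar>)
        \<le> 2 * \<bar>u n - t\<bar>"
      using diff by (intro cSUP_least) auto
    ultimately show "norm (SUP A\<in>sets borel. \<bar>measure (collapsed (u n)) A - measure (collapsed t) A\<bar>)
        \<le> 2 * 1 * \<bar>u n - t\<bar>" by simp
  qed
  then have "limitin Met_TC.tv_topology (\<lambda>n. collapsed (u n)) (collapsed t) sequentially"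
    unfolding Met_TC.limitin_tv_topology mborel_eq_borel using P by auto
  with weak setwise T show ?thesis by blast
qed

lemma not_continuous_map_of_collapsed:
  fixes D :: "real measure \<Rightarrow> ereal"
  assumes T: "T \<in> {Met_TC.weak_topology, Met_TC.setwise_topology, Met_TC.tv_topology}"
    and u: "u \<longlonglongrightarrow> t" and Dom: "\<And>n. collapsed (u n) \<in> Dom" "collapsed t \<in> Dom"
    and D: "\<not> (\<lambda>n. D (collapsed (u n))) \<longlonglongrightarrow> D (collapsed t)"
  shows "\<not> continuous_map (subtopology T Dom) euclidean D"
proof
  assume cont: "continuous_map (subtopology T Dom) euclidean D"
  have "limitin (subtopology T Dom) (\<lambda>n. collapsed (u n)) (collapsed t) sequentially"
    using limitin_collapsed[OF u T] Dom by (simp add: limitin_subtopology)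
  from continuous_map_limit[OF cont this] D show False
    by (simp add: o_def)
qed

section \<open>Dimensions along the path\<close>

lemma dim_H0_collapsed_0: "1 \<le> Met_TC.dim_H0 (collapsed 0)"
  unfolding Met_TC.dim_H0_def mborel_eq_borel
proof (rule Inf_greatest, clarify)
  fix A :: "real set" assume A: "A \<in> sets borel" "0 < measure (collapsed 0) A"
  then show "1 \<le> Met_TC.HD A"
    using measure_collapsed_le[of 0 A] by (intro one_le_HD) auto
qed

lemma dim_H0_collapsed_pos:
  assumes "0 < t" "t \<le> 1"
  shows "Met_TC.dim_H0 (collapsed t) = 0"
proof (rule antisym)
  have "Met_TC.dim_H0 (collapsed t) \<le> Met_TC.HD {0 :: real}"
    unfolding Met_TC.dim_H0_def mborel_eq_borel
    using measure_collapsed_atom[of t] assms by (intro Inf_lower) (auto intro!: exI[of _ "{0}"])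
  then show "Met_TC.dim_H0 (collapsed t) \<le> 0" by (simp add: Met_TC.HD_singleton)
  show "0 \<le> Met_TC.dim_H0 (collapsed t)"
    unfolding Met_TC.dim_H0_def by (rule Inf_greatest) (auto simp: Met_TC.HD_nonneg)
qed

lemma dim_H1_collapsed_less_1:
  assumes "0 \<le> t" "t < 1"
  shows "1 \<le> Met_TC.dim_H1 (collapsed t)"
  unfolding Met_TC.dim_H1_def mborel_eq_borel
proof (rule Inf_greatest, elim CollectE exE conjE, hypsubst)
  fix A :: "real set" assume A: "A \<in> sets borel" "measure (collapsed t) A = 1"
  have "emeasure lborel A \<noteq> 0"
  proof
    assume "emeasure lborel A = 0"
    from measure_collapsed_le[OF assms(1) _ A(1) this] show False using A(2) assms by simp
  qed
  then show "1 \<le> Met_TC.HD A" by (rule one_le_HD)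
qed

lemma dim_H1_collapsed_1: "Met_TC.dim_H1 (collapsed 1) \<le> 0"
proof -
  have "measure (collapsed 1) {0} = 1"
    using measure_collapsed_atom[of 1] prob_space.prob_le_1[OF prob_space_collapsed]
    by (intro antisym) auto
  then have "Met_TC.dim_H1 (collapsed 1) \<le> Met_TC.HD {0 :: real}"
    unfolding Met_TC.dim_H1_def mborel_eq_borel
    by (intro Inf_lower) (auto intro!: exI[of _ "{0}"])
  then show ?thesis by (simp add: Met_TC.HD_singleton)
qed

lemma dim_C_MC_collapsed_pos:
  assumes "0 < t" "t \<le> 1"
  shows "collapsed t \<in> Met_TC.dim_C_domain" "Met_TC.dim_C (collapsed t) = 0"
    and "collapsed t \<in> Met_TC.dim_MC_domain" "Met_TC.dim_MC (collapsed t) = 0"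
proof -
  let ?\<nu> = "collapsed t"
  have atom: "0 < measure ?\<nu> {0}" using measure_collapsed_atom[of t] assms by simp
  then have "0 < measure ?\<nu> {0} / 2" by simp
  note * = dim_C_dim_MC_eqI[OF prob_space_collapsed sets_collapsed this
      MC_ratio_tendsto_0_of_atom[OF prob_space_collapsed sets_collapsed atom]]
  show "?\<nu> \<in> Met_TC.dim_C_domain" "Met_TC.dim_C ?\<nu> = 0"
    "?\<nu> \<in> Met_TC.dim_MC_domain" "Met_TC.dim_MC ?\<nu> = 0"
    by (rule *; assumption)+
qed

lemma measure_unif_cball_le:
  assumes "0 \<le> r"
  shows "measure unif (cball x r) \<le> 2 * r"
proof -
  have "measure unif (cball x r) \<le> measure lborel (cball x r)"
    by (subst measure_unif) (auto intro!: measure_mono_fmeasurable fmeasurableI simp: cball_eq_atLeastAtMost)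
  then show ?thesis using assms by (simp add: cball_eq_atLeastAtMost)
qed

text \<open>If \<open>[0,1]\<close> cuts off the ball on at most one side, the half on the other side, of length \<open>r\<close>,
  remains; if it does so on both sides, the whole unit interval remains.\<close>

lemma le_measure_unif_cball:
  assumes "0 \<le> r" "r \<le> 1" "x \<in> {0..1}"
  shows "r \<le> measure unif (cball x r)"
proof -
  have "{0..1} \<inter> cball x r = {max 0 (x - r)..min 1 (x + r)}"
    by (auto simp: cball_eq_atLeastAtMost)
  then show ?thesis using assms by (simp add: measure_unif) (auto simp: min_def max_def)
qed

lemma MC_ratio_unif:
  assumes A: "A \<in> sets borel" and "1 - 1 / 2 \<le> measure unif A"
  shows "(Met_TC.MC_ratio unif A \<longlongrightarrow> 1) (at_right 0)"
proof -
  have small: "\<forall>\<^sub>F r::real in at_right 0. 0 < r \<and> r < 1"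
    using eventually_at_right_real[of 0 1] by simp
  have "(Met_TC.MC_ratio unif A \<longlongrightarrow> ereal 1) (at_right 0)"
  proof (rule MC_ratio_tendsto[OF unif.prob_space_axioms sets_unif A, of "{0..1} \<inter> A" 1 _ 2])
    show "0 < measure unif ({0..1} \<inter> A)"
      using assms by (simp add: measure_unif Int_absorb1 flip: Int_assoc)
    show "\<forall>\<^sub>F r in at_right 0. \<forall>x\<in>{0..1} \<inter> A. 1 * r powr 1 \<le> measure unif (cball x r)"
      using small by eventually_elim (auto simp: le_measure_unif_cball)
    show "\<forall>\<^sub>F r in at_right 0. \<forall>x. measure unif (cball x r) \<le> 2 * r powr 1"
      using small by eventually_elim (auto simp: measure_unif_cball_le)
  qed (use A in auto)
  then show ?thesis by (simp add: one_ereal_def)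
qed

lemmas dim_C_MC_unif =
  dim_C_dim_MC_eqI[OF unif.prob_space_axioms sets_unif half_gt_zero[OF zero_less_one] MC_ratio_unif]

theorem theorem3p1:
  shows "\<forall>(D, Dom) \<in>
      {(Metric_space.dim_H0, Metric_space.prob_measures),
       (Metric_space.dim_H1, Metric_space.prob_measures),
       (Metric_space.dim_C, Metric_space.dim_C_domain),
       (Metric_space.dim_MC, Metric_space.dim_MC_domain)}.
    \<forall>T \<in> {Metric_space.weak_topology, Metric_space.setwise_topology, Metric_space.tv_topology}.
      \<exists>(X :: real set) d. Metric_space X d \<and>
        \<not> continuous_map (subtopology (T X d) (Dom X d)) euclidean (D X d)"
proof -
  have P: "collapsed t \<in> Met_TC.prob_measures" for t
    by (simp add: prob_measures_eq prob_space_collapsed)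
  \<comment> \<open>Any null sequence strictly between \<open>0\<close> and \<open>1\<close> would do; it approaches the two ends of the path
    as \<open>u\<close> and as \<open>1 - u\<close>.\<close>
  define u where "u n = 1 / (real n + 2)" for n
  have u: "0 < u n" "u n < 1" for n by (auto simp: u_def)
  have u0: "u \<longlonglongrightarrow> 0"
    using LIMSEQ_ignore_initial_segment[OF lim_1_over_n, of 2] by (simp add: u_def[abs_def] add.commute)
  then have u1: "(\<lambda>n. 1 - u n) \<longlonglongrightarrow> 1"
    using tendsto_diff[OF tendsto_const u0, of 1] by simp
  have "\<not> (\<lambda>n. Met_TC.dim_H1 (collapsed (1 - u n))) \<longlonglongrightarrow> Met_TC.dim_H1 (collapsed 1)"
  proof
    assume "(\<lambda>n. Met_TC.dim_H1 (collapsed (1 - u n))) \<longlonglongrightarrow> Met_TC.dim_H1 (collapsed 1)"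
    then have "1 \<le> Met_TC.dim_H1 (collapsed 1)"
      by (rule tendsto_lowerbound)
         (use u in \<open>auto intro!: always_eventually dim_H1_collapsed_less_1 simp: less_imp_le\<close>)
    also note dim_H1_collapsed_1
    finally show False by simp
  qed
  note H1 = not_continuous_map_of_collapsed[OF _ u1 P P this]
  have jump_at_0: "\<not> continuous_map (subtopology T Dom) euclidean D"
    if T: "T \<in> {Met_TC.weak_topology, Met_TC.setwise_topology, Met_TC.tv_topology}"
      and Dom: "\<And>t. 0 \<le> t \<Longrightarrow> t \<le> 1 \<Longrightarrow> collapsed t \<in> Dom"
      and pos: "\<And>t. 0 < t \<Longrightarrow> t \<le> 1 \<Longrightarrow> D (collapsed t) = 0"
      and zero: "1 \<le> D (collapsed 0)"
    for T Dom and D :: "real measure \<Rightarrow> ereal"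
  proof (rule not_continuous_map_of_collapsed[OF T u0])
    show "\<not> (\<lambda>n. D (collapsed (u n))) \<longlonglongrightarrow> D (collapsed 0)"
      using u pos zero by (auto simp: LIMSEQ_const_iff less_imp_le)
  qed (use u Dom in \<open>auto simp: less_imp_le\<close>)
  have H0: "\<not> continuous_map (subtopology T Met_TC.prob_measures) euclidean Met_TC.dim_H0"
    if "T \<in> {Met_TC.weak_topology, Met_TC.setwise_topology, Met_TC.tv_topology}"
    for T :: "real measure topology"
    using that by (rule jump_at_0) (auto simp: P dim_H0_collapsed_0 dim_H0_collapsed_pos)
  have Dom: "collapsed t \<in> Met_TC.dim_C_domain" "collapsed t \<in> Met_TC.dim_MC_domain"
    if "0 \<le> t" "t \<le> 1" for t
    using that dim_C_MC_unif(1,3) dim_C_MC_collapsed_pos(1,3)[of t]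
    by (cases "t = 0"; simp add: collapsed_0)+
  have C: "\<not> continuous_map (subtopology T Met_TC.dim_C_domain) euclidean Met_TC.dim_C"
    if "T \<in> {Met_TC.weak_topology, Met_TC.setwise_topology, Met_TC.tv_topology}"
    for T :: "real measure topology"
    using that by (rule jump_at_0) (auto simp: Dom collapsed_0 dim_C_MC_unif dim_C_MC_collapsed_pos)
  have MC: "\<not> continuous_map (subtopology T Met_TC.dim_MC_domain) euclidean Met_TC.dim_MC"
    if "T \<in> {Met_TC.weak_topology, Met_TC.setwise_topology, Met_TC.tv_topology}"
    for T :: "real measure topology"
    using that by (rule jump_at_0) (auto simp: Dom collapsed_0 dim_C_MC_unif dim_C_MC_collapsed_pos)
  \<comment> \<open>The mappings and topologies are functions of the space, so they are instantiated here as
    higher-order variables.\<close>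
  have real_line: "\<exists>(X :: real set) d. Metric_space X d \<and>
      \<not> continuous_map (subtopology (T X d) (Dom X d)) euclidean (D X d)"
    if "\<not> continuous_map (subtopology (T UNIV dist) (Dom UNIV dist)) euclidean (D UNIV dist)"
    for T Dom and D :: "real set \<Rightarrow> (real \<Rightarrow> real \<Rightarrow> real) \<Rightarrow> real measure \<Rightarrow> ereal"
    using that Met_TC.Metric_space_axioms by blast
  show ?thesis
    by (auto intro!: real_line H0 H1 C MC)
qed

end
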